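(* Let $0<r<1$ and $R(r,1)=\{z\in\mathbb{C} : r<|z|<1\}$. For all $x,y\in R(r,1)$ with $|y|\leq|x|$, $$\delta_{R(r,1)}(x,y)=\max\left\{\rho_{\mathbb{B}^2}(x,y),\ \rho_{\mathbb{B}^2}\!\left(\frac{rx}{|x|^2},\frac{ry}{|y|^2}\right),\ \sup_{v\in[\mu,\pi]}\log\left(1+\left|e^{-u(v)i},\,|x|,\,re^{vi},\,|y|e^{\mu i}\right|\right)\right\},$$ where $\mu\in[0,\pi]$ is the value of the angle at the origin between $x$ and $y$, $|\cdot,\cdot,\cdot,\cdot|$ is the cross-ratio, and $$u(v)=\arcsin\left(\frac{-c_2+\sqrt{c_2^2-4c_1c_3}}{2c_1}\right)$$ with $$c_1=|x|^2(1+r^2)^2+r^2(1+|x|^2)^2-2r|x|(1+r^2)(1+|x|^2)\cos(v),$$ $$c_2=4r|x|\sin(v)\bigl(|x|(1+r^2)-r(1+|x|^2)\cos(v)\bigr),$$ $$c_3=-r^2\sin^2(v)(1-|x|^2)^2.$$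
   Context: Cross-ratio: for points $a,b,c,d\in\mathbb{R}^n$, $|a,b,c,d|=\dfrac{|a-c||b-d|}{|a-b||c-d|}$. Möbius metric: for a domain $G\subset\overline{\mathbb{R}}^n=\mathbb{R}^n\cup\{\infty\}$ whose complement in $\overline{\mathbb{R}}^n$ contains at least two points and $x,y\in G$, $\delta_G(x,y)=\sup_{a,b\in\partial G}\log(1+|a,x,b,y|)$ (the cross-ratio being $0$ when $a=b$ or $x=y$). Hyperbolic metric of the unit disk $\mathbb{B}^2=\{z\in\mathbb{C}:|z|<1\}$: $\tanh\dfrac{\rho_{\mathbb{B}^2}(x,y)}{2}=\left|\dfrac{x-y}{1-x\overline{y}}\right|$. The angle at the origin between $x$ and $y$ is the angle in $[0,\pi]$ between the segments $[0,x]$ and $[0,y]$. *)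

theory Defs
  imports "HOL-Analysis.Analysis"
begin

definition cross_ratio :: "'a::real_normed_vector \<Rightarrow> 'a \<Rightarrow> 'a \<Rightarrow> 'a \<Rightarrow> real" where
  "cross_ratio a b c d = (norm (a - c) * norm (b - d)) / (norm (a - b) * norm (c - d))"

text \<open>
  The extended space is modelled by the type \<open>'a option\<close>, with \<open>None\<close> as the point at infinity
  and the topology \<open>Alexandroff_compactification euclidean\<close>.
  A factor \<open>|p - q|\<close> with exactly one infinite argument is set to 1, i.e. it is omitted from the
  cross-ratio; this is the limit value of the cross-ratio, since the factors containing a given
  point come in pairs, one in the numerator and one in the denominator.
\<close>

definition ext_dist :: "'a::real_normed_vector option \<Rightarrow> 'a option \<Rightarrow> real" where
  "ext_dist p q =
     (if p = q then 0
      else (case (p, q) of (Some a, Some b) \<Rightarrow> norm (a - b) | _ \<Rightarrow> 1))"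

definition ext_cross_ratio ::
    "'a::real_normed_vector option \<Rightarrow> 'a option \<Rightarrow> 'a option \<Rightarrow> 'a option \<Rightarrow> real" where
  "ext_cross_ratio a b c d = (ext_dist a c * ext_dist b d) / (ext_dist a b * ext_dist c d)"

lemma ext_cross_ratio_Some [simp]:
  "ext_cross_ratio (Some a) (Some b) (Some c) (Some d) = cross_ratio a b c d"
  by (simp add: ext_cross_ratio_def cross_ratio_def ext_dist_def)

text \<open>
  The Moebius metric of a domain \<open>G\<close> of the extended space whose complement has at least two points.
  The convention that the cross-ratio is 0 when \<open>a = b\<close> or \<open>x = y\<close> holds automatically.
\<close>

definition moebius_metric :: "'a::euclidean_space option set \<Rightarrow> 'a option \<Rightarrow> 'a option \<Rightarrow> real" where
  "moebius_metric G x y =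
     (let B = Alexandroff_compactification euclidean frontier_of G
      in SUP (a, b) \<in> B \<times> B. ln (1 + ext_cross_ratio a x b y))"

text \<open>The hyperbolic metric of the unit disk; only meaningful for points of the open unit disk.\<close>

definition hyperbolic_dist :: "complex \<Rightarrow> complex \<Rightarrow> real" where
  "hyperbolic_dist x y = 2 * artanh (cmod ((x - y) / (1 - x * cnj y)))"

definition annulus :: "real \<Rightarrow> real \<Rightarrow> complex set" where
  "annulus r s = {z. r < cmod z \<and> cmod z < s}"

definition angle_at_origin :: "'a::real_inner \<Rightarrow> 'a \<Rightarrow> real" where
  "angle_at_origin x y = arccos ((x \<bullet> y) / (norm x * norm y))"

text \<open>In the following definitions \<open>s\<close> stands for \<open>|x|\<close>.\<close>

definition coeff1 :: "real \<Rightarrow> real \<Rightarrow> real \<Rightarrow> real" where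
  "coeff1 r s v = s\<^sup>2 * (1 + r\<^sup>2)\<^sup>2 + r\<^sup>2 * (1 + s\<^sup>2)\<^sup>2
                    - 2 * r * s * (1 + r\<^sup>2) * (1 + s\<^sup>2) * cos v"

definition coeff2 :: "real \<Rightarrow> real \<Rightarrow> real \<Rightarrow> real" where
  "coeff2 r s v = 4 * r * s * sin v * (s * (1 + r\<^sup>2) - r * (1 + s\<^sup>2) * cos v)"

definition coeff3 :: "real \<Rightarrow> real \<Rightarrow> real \<Rightarrow> real" where
  "coeff3 r s v = - (r\<^sup>2 * (sin v)\<^sup>2 * (1 - s\<^sup>2)\<^sup>2)"

definition outer_angle :: "real \<Rightarrow> real \<Rightarrow> real \<Rightarrow> real" where
  "outer_angle r s v =
     arcsin ((- coeff2 r s v + sqrt ((coeff2 r s v)\<^sup>2 - 4 * coeff1 r s v * coeff3 r s v))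
               / (2 * coeff1 r s v))"

lemma tanh_artanh_aux:
  fixes t :: real
  assumes "\<bar>t\<bar> < 1"
  shows "tanh (artanh t) = t"
proof -
  have p: "1 + t > 0" "1 - t > 0"
    using assms by auto
  have "exp (2 * artanh t) = (1 + t) / (1 - t)"
    using p by (simp add: artanh_def)
  then have e: "exp (- 2 * artanh t) = (1 - t) / (1 + t)"
    using p by (simp add: exp_minus)
  show ?thesis
    unfolding tanh_real_altdef e using p by (simp add: field_simps)
qed

lemma tanh_hyperbolic_dist:
  assumes "cmod x < 1" "cmod y < 1"
  shows "tanh (hyperbolic_dist x y / 2) = cmod ((x - y) / (1 - x * cnj y))"
proof -
  have eq: "(cmod (1 - x * cnj y))\<^sup>2 - (cmod (x - y))\<^sup>2 = (1 - (cmod x)\<^sup>2) * (1 - (cmod y)\<^sup>2)"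
    unfolding cmod_power2 by (simp add: power2_eq_square algebra_simps)
  have "(cmod x)\<^sup>2 < 1" "(cmod y)\<^sup>2 < 1"
    using assms by (simp_all add: abs_square_less_1)
  then have "(1 - (cmod x)\<^sup>2) * (1 - (cmod y)\<^sup>2) > 0"
    by simp
  with eq have "(cmod (x - y))\<^sup>2 < (cmod (1 - x * cnj y))\<^sup>2"
    by linarith
  then have lt: "cmod (x - y) < cmod (1 - x * cnj y)"
    by (rule power2_less_imp_less) simp
  then have "cmod (1 - x * cnj y) > 0"
    by (rule le_less_trans [rotated]) simp
  with lt have "cmod ((x - y) / (1 - x * cnj y)) < 1"
    by (simp add: norm_divide)
  then show ?thesis
    unfolding hyperbolic_dist_def by (simp add: tanh_artanh_aux)
qed

end

theory Submission
  imports Defs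
begin

text \<open>
  Each of the points \<open>a\<close>, \<open>b\<close> in the supremum lies on the unit circle or on \<open>|z| = r\<close>. If both lie on
  the unit circle, the maximum is the hyperbolic distance, by Ptolemy's inequality; the inversion
  \<open>z \<mapsto> r z / |z|\<^sup>2\<close> reduces the case of two points on the inner circle to this one. If \<open>a\<close> is on the
  outer and \<open>b = r e\<^sup>i\<^sup>v\<close> on the inner circle, \<open>e\<^sup>-\<^sup>i\<^sup>u\<^sup>(\<^sup>v\<^sup>)\<close> is the best choice of \<open>a\<close>, and moving \<open>b\<close> to
  the far side of \<open>y\<close> as seen from \<open>x\<close> is no loss. The opposite case is never better because \<open>|y| \<le> |x|\<close>.
\<close>

section \<open>The frontier of the annulus in the extended plane\<close>

text \<open>Infinity does not enter: the closed annulus is compact, so its image stays closed in the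
  compactification. The supremum thus runs over finite boundary points only.\<close>

lemma frontier_of_Some_annulus:
  assumes "0 < r" "r < 1"
  shows "Alexandroff_compactification euclidean frontier_of (Some ` annulus r 1)
         = Some ` (sphere 0 1 \<union> sphere 0 r)"
proof -
  let ?X = "Alexandroff_compactification (euclidean :: complex topology)"
  let ?K = "{z::complex. r \<le> cmod z \<and> cmod z \<le> 1}"
  have annulus_eq: "annulus r 1 = ball 0 1 - cball 0 r" and K_eq: "?K = cball 0 1 - ball 0 r"
    by (auto simp: annulus_def)
  have K: "compact ?K"
    unfolding K_eq by (intro compact_diff compact_cball open_ball)
  have opn: "openin ?X (Some ` annulus r 1)"
    unfolding annulus_eq by (simp add: open_Diff)
  have cls: "closedin ?X (Some ` ?K)"
    by (simp add: K compact_imp_closed)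
  \<comment> \<open>Each point of the closed annulus is a limit along its own ray through the
    origin, so only closure of the real interval \<open>{r<..<1}\<close> is needed.\<close>
  have "?K \<subseteq> closure (annulus r 1)"
  proof
    fix z assume z: "z \<in> ?K"
    define w where "w = sgn z"
    have zw: "z = of_real (cmod z) * w" and w: "cmod w = 1"
      using z assms by (auto simp: w_def sgn_eq norm_divide)
    have "(\<lambda>t. complex_of_real t * w) ` closure {r<..<1} \<subseteq> closure (annulus r 1)"
    proof (rule image_closure_subset)
      show "continuous_on (closure {r<..<1}) (\<lambda>t. complex_of_real t * w)"
        by (intro continuous_intros)
      show "(\<lambda>t. complex_of_real t * w) ` {r<..<1} \<subseteq> closure (annulus r 1)"
        using assms w by (intro order_trans[OF _ closure_subset]) (auto simp: annulus_def norm_mult)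
    qed simp
    moreover have "cmod z \<in> closure {r<..<1}"
      using z assms by simp
    ultimately show "z \<in> closure (annulus r 1)"
      using zw by blast
  qed
  moreover have "continuous_map euclidean ?X (Some :: complex \<Rightarrow> _)"
    by (rule continuous_map_Some)
  ultimately have "Some ` ?K \<subseteq> ?X closure_of (Some ` annulus r 1)"
    using continuous_map_image_closure_subset[of euclidean ?X Some "annulus r 1"] by auto
  moreover have "?X closure_of (Some ` annulus r 1) \<subseteq> Some ` ?K"
    by (rule closure_of_minimal[OF _ cls]) (auto simp: annulus_def)
  ultimately have "?X closure_of (Some ` annulus r 1) = Some ` ?K"
    by blast
  then show ?thesis
    using assms opn by (auto simp: frontier_of_def interior_of_openin annulus_def simp flip: image_set_diff[OF inj_Some])
qed

subsection \<open>Boundary points on one circle\<close>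

lemma norm_one_minus_mult_cnj_greater:
  assumes "cmod x < 1" "cmod y < 1"
  shows "cmod (x - y) < cmod (1 - x * cnj y)"
proof -
  have eq: "(cmod (1 - x * cnj y))\<^sup>2 - (cmod (x - y))\<^sup>2 = (1 - (cmod x)\<^sup>2) * (1 - (cmod y)\<^sup>2)"
    unfolding cmod_power2 by (simp add: power2_eq_square algebra_simps)
  have "(1 - (cmod x)\<^sup>2) * (1 - (cmod y)\<^sup>2) > 0"
    using assms by (simp add: abs_square_less_1)
  with eq have "(cmod (x - y))\<^sup>2 < (cmod (1 - x * cnj y))\<^sup>2"
    by linarith
  then show ?thesis
    by (rule power2_less_imp_less) simp
qed

text \<open>Doubling \<open>artanh\<close> gives a logarithm of the shape \<open>ln (1 + c)\<close>
  found in the Moebius metric, so cross-ratios need only be compared with \<open>c\<close>.\<close>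

lemma hyperbolic_dist_eq_ln:
  assumes "cmod x < 1" "cmod y < 1"
  shows "hyperbolic_dist x y
         = ln (1 + 2 * cmod (x - y) / (cmod (1 - x * cnj y) - cmod (x - y)))"
proof -
  define d m where "d = cmod (x - y)" and "m = cmod (1 - x * cnj y)"
  have "0 \<le> d" "d < m"
    using norm_one_minus_mult_cnj_greater[OF assms] by (auto simp: d_def m_def)
  then have "(1 + d / m) / (1 - d / m) = 1 + 2 * d / (m - d)"
    by (simp add: divide_simps)
  then show ?thesis
    by (simp add: hyperbolic_dist_def artanh_def norm_divide d_def m_def)
qed

text \<open>Ptolemy's inequality for \<open>a, b, x, y\<close> and for \<open>a, b, x\<close> and the inverse point of \<open>y\<close>.\<close>

lemma dist_unit_circle_le:
  assumes "cmod a = 1" "cmod b = 1"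
  shows "cmod (a - b) * (cmod (1 - x * cnj y) - cmod (x - y)) \<le> 2 * (cmod (a - x) * cmod (b - y))"
proof -
  \<comment> \<open>On the unit circle the distances to \<open>y\<close> and to its inverse point
    are proportional, so both Ptolemy inequalities involve the same factors.\<close>
  have inv: "cmod (1 - c * cnj y) = cmod (c - y)" if "cmod c = 1" for c
  proof -
    have "c * cnj c = 1"
      using that by (simp add: complex_norm_square[symmetric])
    then have "c * cnj (c - y) = 1 - c * cnj y"
      by (simp add: algebra_simps)
    then show ?thesis
      using that by (metis complex_mod_cnj mult_1 norm_mult)
  qed
  have "(a - b) * (1 - x * cnj y) = (a - x) * (1 - b * cnj y) - (b - x) * (1 - a * cnj y)"
    by (simp add: algebra_simps)
  then have "cmod (a - b) * cmod (1 - x * cnj y)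
      \<le> cmod (a - x) * cmod (1 - b * cnj y) + cmod (b - x) * cmod (1 - a * cnj y)"
    by (metis norm_mult norm_triangle_ineq4)
  then have 1: "cmod (a - b) * cmod (1 - x * cnj y)
      \<le> cmod (a - x) * cmod (b - y) + cmod (b - x) * cmod (a - y)"
    using assms by (simp add: inv)
  \<comment> \<open>This removes the product with the opposite pairing from the first inequality,
    which leaves the factor 2.\<close>
  have "(b - x) * (a - y) = (a - x) * (b - y) + (a - b) * (y - x)"
    by (simp add: algebra_simps)
  then have 2: "cmod (b - x) * cmod (a - y) \<le> cmod (a - x) * cmod (b - y) + cmod (a - b) * cmod (x - y)"
    by (metis norm_minus_commute norm_mult norm_triangle_ineq)
  show ?thesis
    using 1 2 by (simp add: algebra_simps)
qed

lemma ln_cross_ratio_le_hyperbolic_dist: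
  assumes "cmod x < 1" "cmod y < 1" "cmod a = 1" "cmod b = 1"
  shows "ln (1 + cross_ratio a x b y) \<le> hyperbolic_dist x y"
proof -
  have "a \<noteq> x" "b \<noteq> y"
    using assms by auto
  then have pos: "cmod (a - x) * cmod (b - y) > 0"
    by simp
  have m: "cmod (1 - x * cnj y) - cmod (x - y) > 0"
    using norm_one_minus_mult_cnj_greater[OF assms(1,2)] by simp
  have "cmod (x - y) * (cmod (a - b) * (cmod (1 - x * cnj y) - cmod (x - y)))
      \<le> cmod (x - y) * (2 * (cmod (a - x) * cmod (b - y)))"
    by (intro mult_left_mono dist_unit_circle_le assms) auto
  then have "cross_ratio a x b y \<le> 2 * cmod (x - y) / (cmod (1 - x * cnj y) - cmod (x - y))"
    unfolding cross_ratio_def pos_divide_le_eq[OF pos] times_divide_eq_left pos_le_divide_eq[OF m]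
    by (simp add: mult_ac)
  moreover have "0 \<le> cross_ratio a x b y"
    by (simp add: cross_ratio_def)
  ultimately show ?thesis
    unfolding hyperbolic_dist_eq_ln[OF assms(1,2)] by (intro ln_mono) auto
qed

text \<open>The maximum is attained at the end points of the geodesic through \<open>x\<close> and \<open>y\<close>, which are found
  by moving \<open>x\<close> to the origin.\<close>

lemma hyperbolic_dist_attained:
  assumes "cmod x < 1" "cmod y < 1"
  obtains a b where "cmod a = 1" "cmod b = 1" "ln (1 + cross_ratio a x b y) = hyperbolic_dist x y"
proof (cases "x = y")
  case True
  then show ?thesis
    using that[of 1 1] by (simp add: cross_ratio_def hyperbolic_dist_def)
next
  case False
  \<comment> \<open>\<open>w\<close> is the image of \<open>y\<close> under the disk automorphism
    taking \<open>x\<close> to 0, and \<phi> is the inverse automorphism. The geodesic through 0 and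
    \<open>w\<close> is a diameter with end points \<open>e\<close> and \<open>- e\<close>.\<close>
  define w where "w = (y - x) / (1 - cnj x * y)"
  define \<phi> where "\<phi> = (\<lambda>z. (z + x) / (1 + cnj x * z))"
  define e where "e = sgn w"
  have m0: "cmod (x - y) < cmod (1 - x * cnj y)"
    by (rule norm_one_minus_mult_cnj_greater[OF assms])
  have cm: "cmod (1 - cnj x * y) = cmod (1 - x * cnj y)"
    by (metis complex_cnj_cnj complex_cnj_diff complex_cnj_mult complex_cnj_one complex_mod_cnj)
  have m1: "1 - cnj x * y \<noteq> 0"
    using m0 cm by (metis norm_not_less_zero norm_zero)
  have w: "cmod w = cmod (x - y) / cmod (1 - x * cnj y)"
    by (simp add: w_def norm_divide cm norm_minus_commute)
  have w1: "cmod w < 1" "w \<noteq> 0"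
    using m0 False m1 unfolding w by (auto simp: w_def divide_less_eq)
  have e: "cmod e = 1" "w = of_real (cmod w) * e"
    using w1 by (auto simp: e_def sgn_eq norm_divide)
  have nz: "1 + cnj x * z \<noteq> 0" if "cmod z \<le> 1" for z
  proof
    assume "1 + cnj x * z = 0"
    then have "cmod x * cmod z = 1"
      by (metis add_eq_0_iff2 complex_mod_cnj norm_minus_cancel norm_mult norm_one)
    moreover have "cmod x * cmod z \<le> cmod x * 1"
      using that by (intro mult_left_mono) auto
    ultimately show False
      using assms by simp
  qed
  have diff: "\<phi> z - \<phi> z' = (z - z') * (1 - x * cnj x) / ((1 + cnj x * z) * (1 + cnj x * z'))"
    if "cmod z \<le> 1" "cmod z' \<le> 1" for z z'
    using nz[OF that(1)] nz[OF that(2)] by (simp add: \<phi>_def divide_simps) (simp add: algebra_simps)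
  have x0: "1 - x * cnj x \<noteq> 0"
    using norm_one_minus_mult_cnj_greater[OF assms(1) assms(1)] by auto
  \<comment> \<open>By \<open>diff\<close>, each point contributes its factor \<open>N\<close> once
    above and once below the fraction bar, so all of them cancel.\<close>
  have cr: "cross_ratio (\<phi> a) (\<phi> p) (\<phi> b) (\<phi> q) = cross_ratio a p b q"
    if "cmod a \<le> 1" "cmod p \<le> 1" "cmod b \<le> 1" "cmod q \<le> 1" for a p b q
  proof -
    define N where "N z = cmod (1 + cnj x * z)" for z
    define k where "k = cmod (1 - x * cnj x)"
    have "k \<noteq> 0" "N a \<noteq> 0" "N b \<noteq> 0" "N p \<noteq> 0" "N q \<noteq> 0"
      using that nz x0 by (simp_all add: N_def k_def)
    then show ?thesis
      using that by (simp add: cross_ratio_def diff norm_mult norm_divide flip: N_def k_def)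
  qed
  have "1 + cnj x * w = (1 - x * cnj x) / (1 - cnj x * y)" "w + x = y * (1 - x * cnj x) / (1 - cnj x * y)"
    using m1 by (auto simp: w_def field_simps)
  then have \<phi>w: "\<phi> w = y" and \<phi>0: "\<phi> 0 = x"
    using m1 x0 by (auto simp: \<phi>_def)
  have unit: "cmod (\<phi> z) = 1" if "cmod z = 1" for z
  proof -
    have "z * cnj z = 1"
      using that by (simp add: complex_norm_square[symmetric])
    then have "z * cnj (1 + cnj x * z) = z + x"
      by (simp add: algebra_simps)
    then have "cmod (z + x) = cmod (1 + cnj x * z)"
      using that by (metis complex_mod_cnj mult_1 norm_mult)
    then show ?thesis
      using nz[of z] that by (simp add: \<phi>_def norm_divide)
  qed
  have "cmod (e - w) = 1 - cmod w"
  proof -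
    have "e - w = of_real (1 - cmod w) * e"
      by (subst e(2)) (simp add: algebra_simps)
    then have "cmod (e - w) = \<bar>1 - cmod w\<bar> * cmod e"
      by (metis norm_mult norm_of_real)
    then show ?thesis
      using w1 e by simp
  qed
  moreover have "cmod (- e - e) = 2"
    using e by (simp add: norm_mult flip: minus_add_distrib mult_2)
  ultimately have "cross_ratio (- e) 0 e w = 2 * cmod w / (1 - cmod w)"
    using e by (simp add: cross_ratio_def)
  moreover have "2 * cmod w / (1 - cmod w)
      = 2 * cmod (x - y) / (cmod (1 - x * cnj y) - cmod (x - y))"
    using m0 unfolding w by (auto simp: field_simps)
  moreover have "cross_ratio (\<phi> (- e)) x (\<phi> e) y = cross_ratio (- e) 0 e w"
    using cr[of "- e" 0 e w] e w1 by (simp add: \<phi>0 \<phi>w)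
  ultimately show ?thesis
    using that[of "\<phi> (- e)" "\<phi> e"] unit e by (simp add: hyperbolic_dist_eq_ln[OF assms])
qed

text \<open>The map is z \<mapsto> k / \<open>cnj z\<close>; it scales |z - w| by |k| / (|z| |w|),
  and these factors cancel in the cross-ratio. With k = r it swaps the two boundary circles.\<close>

lemma cross_ratio_inversion:
  fixes a b x y :: complex
  assumes "a \<noteq> 0" "b \<noteq> 0" "x \<noteq> 0" "y \<noteq> 0" "k \<noteq> 0"
  defines "\<iota> \<equiv> \<lambda>z. of_real k * z / of_real ((cmod z)\<^sup>2)"
  shows "cross_ratio (\<iota> a) (\<iota> x) (\<iota> b) (\<iota> y) = cross_ratio a x b y"
proof -
  have \<iota>: "\<iota> z = of_real k / cnj z" if "z \<noteq> 0" for z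
    using that by (simp add: \<iota>_def complex_norm_square divide_simps del: of_real_power)
  have diff: "cmod (\<iota> z - \<iota> w) = \<bar>k\<bar> * cmod (z - w) / (cmod z * cmod w)" if "z \<noteq> 0" "w \<noteq> 0" for z w
  proof -
    have "\<iota> z - \<iota> w = of_real k * cnj (w - z) / (cnj z * cnj w)"
      using that by (simp add: \<iota> field_simps)
    then show ?thesis
      by (simp add: norm_mult norm_divide norm_minus_commute del: complex_cnj_diff)
  qed
  show ?thesis
    using assms(1-5) by (simp add: cross_ratio_def diff field_simps)
qed


subsection \<open>Boundary points on different circles\<close>

lemma norm_polar_diff_power2:
  "(cmod (of_real p * cis \<alpha> - of_real q * cis \<beta>))\<^sup>2 = p\<^sup>2 + q\<^sup>2 - 2 * p * q * cos (\<alpha> - \<beta>)"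
proof -
  have "(cmod (of_real p * cis \<alpha> - of_real q * cis \<beta>))\<^sup>2
      = p\<^sup>2 * ((sin \<alpha>)\<^sup>2 + (cos \<alpha>)\<^sup>2) + q\<^sup>2 * ((sin \<beta>)\<^sup>2 + (cos \<beta>)\<^sup>2)
        - 2 * p * q * cos (\<alpha> - \<beta>)"
    unfolding cmod_power2 cos_diff minus_complex.sel Re_complex_of_real Im_complex_of_real times_complex.sel
      cis.sel by algebra
  then show ?thesis
    by simp
qed

text \<open>With \<open>x\<close> and \<open>y\<close> fixed, only |a - b| / (|a - x| |b - y|)
  matters; the hypothesis compares these quotients with denominators cleared.\<close>

lemma cross_ratio_le:
  fixes a b a' b' x y :: "'a::real_normed_vector"
  assumes "norm (a - b) * (norm (a' - x) * norm (b' - y)) \<le> norm (a' - b') * (norm (a - x) * norm (b - y))"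
    and "a \<noteq> x" "b \<noteq> y" "a' \<noteq> x" "b' \<noteq> y"
  shows "cross_ratio a x b y \<le> cross_ratio a' x b' y"
proof -
  have pos: "norm (a - x) * norm (b - y) > 0" "norm (a' - x) * norm (b' - y) > 0"
    using assms by auto
  have "norm (x - y) * (norm (a - b) * (norm (a' - x) * norm (b' - y)))
      \<le> norm (x - y) * (norm (a' - b') * (norm (a - x) * norm (b - y)))"
    by (intro mult_left_mono assms) auto
  then show ?thesis
    unfolding cross_ratio_def pos_divide_le_eq[OF pos(1)] times_divide_eq_left pos_le_divide_eq[OF pos(2)]
    by (simp add: mult_ac)
qed

text \<open>For fixed \<open>b = r e\<^sup>i\<^sup>v\<close>, the critical points \<open>e\<^sup>-\<^sup>i\<^sup>u\<close> of \<open>|a - b| / |a - s|\<close> on the unit circle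
  are the solutions of the linear equation below in \<open>cos u\<close> and \<open>sin u\<close>; eliminating \<open>cos u\<close> gives
  the quadratic equation with the coefficients \<open>coeff1\<close>, \<open>coeff2\<close>, \<open>coeff3\<close>.\<close>

lemma outer_angle_critical:
  fixes r s v :: real
  assumes "0 < r" "r < s" "s < 1" "0 \<le> v" "v \<le> pi"
  defines "A \<equiv> s * (1 + r\<^sup>2) - r * (1 + s\<^sup>2) * cos v"
    and "B \<equiv> r * (1 + s\<^sup>2) * sin v"
    and "u \<equiv> outer_angle r s v"
  shows "B * cos u = 2 * r * s * sin v + A * sin u" "0 \<le> sin u" "0 \<le> cos u" "0 < A" "0 \<le> B"
    "0 \<le> u" "u \<le> pi"
proof -
  define D where "D = 2 * r * s * sin v"
  have sv: "0 \<le> sin v"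
    using assms by (simp add: sin_ge_zero)
  have "r * (1 + s\<^sup>2) * cos v \<le> r * (1 + s\<^sup>2) * 1"
    using assms by (intro mult_left_mono) auto
  moreover have "s * (1 + r\<^sup>2) - r * (1 + s\<^sup>2) = (s - r) * (1 - r * s)"
    by (simp add: power2_eq_square algebra_simps)
  moreover have "r * s < 1"
    using assms mult_strict_mono[of r 1 s 1] by simp
  ultimately show A: "0 < A"
    using assms(2) mult_pos_pos[of "s - r" "1 - r * s"] unfolding A_def by linarith
  show B: "0 \<le> B"
    using assms sv by (simp add: B_def)
  \<comment> \<open>\<open>D \<le> B\<close> makes \<open>coeff3\<close> nonpositive, so the
    quadratic has a nonnegative root.\<close>
  have "B - D = r * sin v * (1 - s)\<^sup>2"
    by (simp add: B_def D_def power2_eq_square algebra_simps)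
  moreover have "0 \<le> r * sin v * (1 - s)\<^sup>2" "0 \<le> D"
    using assms sv by (simp_all add: D_def)
  ultimately have D: "0 \<le> D" "D \<le> B"
    by linarith+
  have c1: "coeff1 r s v = A\<^sup>2 + B\<^sup>2"
  proof -
    have "A\<^sup>2 + B\<^sup>2 = s\<^sup>2 * (1 + r\<^sup>2)\<^sup>2 + r\<^sup>2 * (1 + s\<^sup>2)\<^sup>2 * ((sin v)\<^sup>2 + (cos v)\<^sup>2)
        - 2 * r * s * (1 + r\<^sup>2) * (1 + s\<^sup>2) * cos v"
      unfolding A_def B_def by algebra
    then show ?thesis
      by (simp add: coeff1_def)
  qed
  have c2: "coeff2 r s v = 2 * A * D"
    unfolding coeff2_def A_def D_def by algebra
  have c3: "coeff3 r s v = D\<^sup>2 - B\<^sup>2"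
    unfolding coeff3_def B_def D_def by algebra
  define E where "E = sqrt (A\<^sup>2 + B\<^sup>2 - D\<^sup>2)"
  have DB: "D\<^sup>2 \<le> B\<^sup>2"
    using D by (simp add: power_mono)
  then have E2: "E\<^sup>2 = A\<^sup>2 + B\<^sup>2 - D\<^sup>2"
    by (simp add: E_def add_increasing)
  have EA: "A \<le> E"
    unfolding E_def by (rule real_le_rsqrt) (use DB in simp)
  have N: "A\<^sup>2 + B\<^sup>2 > 0"
    using A by (simp add: add_pos_nonneg)
  have "(coeff2 r s v)\<^sup>2 - 4 * coeff1 r s v * coeff3 r s v = (2 * B * E)\<^sup>2"
    unfolding c1 c2 c3 power_mult_distrib E2 by algebra
  then have root: "sqrt ((coeff2 r s v)\<^sup>2 - 4 * coeff1 r s v * coeff3 r s v) = 2 * B * E"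
    using A B EA by simp
  \<comment> \<open>In (p, q) coordinates the line B q - A p = D has normal (-A, B). The point is
    the foot of the perpendicular from 0 plus a multiple of (B, A) reaching the unit circle; the
    plus sign before \<open>E\<close> makes both coordinates nonnegative.\<close>
  define p where "p = (B * E - A * D) / (A\<^sup>2 + B\<^sup>2)"
  define q where "q = (A * E + B * D) / (A\<^sup>2 + B\<^sup>2)"
  have u: "u = arcsin p"
    unfolding u_def outer_angle_def root
    by (rule arg_cong[of _ _ arcsin]) (use N in \<open>simp add: c1 c2 p_def divide_simps, simp add: algebra_simps\<close>)
  have "A * D \<le> E * B"
    using A D EA by (intro mult_mono) auto
  then have p0: "0 \<le> p"
    using N by (simp add: p_def mult.commute)
  have q0: "0 \<le> q"
    using N A B D EA by (simp add: q_def)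
  have "(B * E - A * D)\<^sup>2 + (A * E + B * D)\<^sup>2 = (A\<^sup>2 + B\<^sup>2) * (E\<^sup>2 + D\<^sup>2)"
    by algebra
  also have "\<dots> = (A\<^sup>2 + B\<^sup>2)\<^sup>2"
    by (simp add: E2 power2_eq_square[of "A\<^sup>2 + B\<^sup>2"])
  finally have pq: "p\<^sup>2 + q\<^sup>2 = 1"
    using N by (auto simp: p_def q_def power_divide add_divide_distrib[symmetric])
  then have p1: "p \<le> 1"
    using p0 by (metis abs_of_nonneg le_add_same_cancel1 power2_le_iff_abs_le zero_le_one zero_le_power2 one_power2)
  \<comment> \<open>Since \<open>arcsin\<close> yields a nonnegative cosine, \<open>q0\<close> is
    what identifies \<open>cos u\<close> with \<open>q\<close>.\<close>
  have sin_u: "sin u = p" and "cos u = sqrt (1 - p\<^sup>2)"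
    using p0 p1 by (simp_all add: u cos_arcsin)
  then have cos_u: "cos u = q"
    using pq q0 by (metis add_diff_cancel_left' real_sqrt_unique)
  have "B * q - A * p = (B * (A * E + B * D) - A * (B * E - A * D)) / (A\<^sup>2 + B\<^sup>2)"
    by (simp add: p_def q_def diff_divide_distrib right_diff_distrib)
  also have "B * (A * E + B * D) - A * (B * E - A * D) = D * (A\<^sup>2 + B\<^sup>2)"
    by algebra
  finally have "B * q - A * p = D"
    using N by (auto split: if_splits)
  then show "B * cos u = 2 * r * s * sin v + A * sin u"
    by (simp add: sin_u cos_u D_def)
  show "0 \<le> sin u" "0 \<le> cos u"
    using p0 q0 by (simp_all add: sin_u cos_u)
  show "0 \<le> u"
    using p0 p1 arcsin_le_arcsin[of 0 p] by (simp add: u)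
  have "arcsin p \<le> pi / 2"
    using p0 p1 by (intro arcsin_ubound) auto
  then show "u \<le> pi"
    using pi_ge_zero unfolding u by linarith
qed

text \<open>As a function of \<open>\<theta>\<close>, the difference of the two sides squared is \<open>\<alpha> + \<beta> cos \<theta> + \<gamma> sin \<theta>\<close> with a
  double zero at \<open>-u\<close>, hence a multiple of \<open>1 - cos (\<theta> + u)\<close>.\<close>

lemma outer_angle_maximal:
  fixes r s v \<theta> :: real
  assumes "0 < r" "r < s" "s < 1" "0 \<le> v" "v \<le> pi"
  defines "a' \<equiv> cis (- outer_angle r s v)" and "b \<equiv> of_real r * cis v"
  shows "cmod (cis \<theta> - b) * cmod (a' - of_real s) \<le> cmod (a' - b) * cmod (cis \<theta> - of_real s)"
proof -
  define u where "u = outer_angle r s v"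
  define A where "A = s * (1 + r\<^sup>2) - r * (1 + s\<^sup>2) * cos v"
  define B where "B = r * (1 + s\<^sup>2) * sin v"
  define p q where "p = sin u" and "q = cos u"
  note crit = outer_angle_critical[OF assms(1-5), folded u_def A_def B_def]
  have lin: "B * q = 2 * r * s * sin v + A * p" and pos: "0 \<le> p" "0 \<le> q" "0 < A" "0 \<le> B"
    using crit by (simp_all add: p_def q_def)
  have pq: "p\<^sup>2 + q\<^sup>2 = 1"
    by (simp add: p_def q_def)
  have n1: "(cmod (cis \<alpha> - b))\<^sup>2 = 1 + r\<^sup>2 - 2 * r * cos (\<alpha> - v)" for \<alpha>
    using norm_polar_diff_power2[of 1 \<alpha> r v] by (simp add: b_def)
  have n2: "(cmod (cis \<alpha> - of_real s))\<^sup>2 = 1 + s\<^sup>2 - 2 * s * cos \<alpha>" for \<alpha>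
    using norm_polar_diff_power2[of 1 \<alpha> s 0] by simp
  have a': "a' = cis (- u)"
    by (simp add: a'_def u_def)
  have "(1 + r\<^sup>2 - 2 * r * cos (\<theta> - v)) * (1 + s\<^sup>2 - 2 * s * q)
      - (1 + r\<^sup>2 - 2 * r * (q * cos v - p * sin v)) * (1 + s\<^sup>2 - 2 * s * cos \<theta>)
      = 2 * cos \<theta> * (A + (2 * r * s * sin v) * p) + 2 * sin \<theta> * ((2 * r * s * sin v) * q - B) - 2 * (A * q + B * p)"
    unfolding A_def B_def cos_diff by algebra
  \<comment> \<open>The critical equation turns the coefficients of \<open>cos \<theta>\<close> and
    \<open>sin \<theta>\<close> into q and -p times the common factor A q + B p. Its sign makes -u a
    maximum and not a minimum.\<close>
  also have "2 * r * s * sin v = B * q - A * p"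
    using lin by simp
  also have "A + (B * q - A * p) * p = q * (A * q + B * p)"
    using pq by algebra
  also have "(B * q - A * p) * q - B = - p * (A * q + B * p)"
    using pq by algebra
  finally have "(1 + r\<^sup>2 - 2 * r * cos (\<theta> - v)) * (1 + s\<^sup>2 - 2 * s * q)
      - (1 + r\<^sup>2 - 2 * r * (q * cos v - p * sin v)) * (1 + s\<^sup>2 - 2 * s * cos \<theta>)
      = - (2 * (A * q + B * p) * (1 - cos (\<theta> + u)))"
    by (simp add: cos_add p_def q_def algebra_simps)
  moreover have "0 \<le> 2 * (A * q + B * p) * (1 - cos (\<theta> + u))"
    using pos by simp
  moreover have "cos (- u - v) = q * cos v - p * sin v"
    by (simp add: cos_diff p_def q_def)
  ultimately have "(cmod (cis \<theta> - b))\<^sup>2 * (cmod (a' - of_real s))\<^sup>2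
      \<le> (cmod (a' - b))\<^sup>2 * (cmod (cis \<theta> - of_real s))\<^sup>2"
    unfolding a' n1 n2 by (simp add: q_def)
  then show ?thesis
    unfolding power_mult_distrib[symmetric] by (rule power2_le_imp_le) simp
qed

text \<open>Reflecting in the real axis and, if needed, rotating both points moves the argument of
  \<open>b\<close> into \<open>[\<mu>, \<pi>]\<close>: the factors \<open>|a - x|\<close> and \<open>|b - y|\<close> do not increase and \<open>|a - b|\<close> does not decrease.\<close>

lemma cross_ratio_outer_inner_le:
  fixes a b :: complex and r s t \<mu> :: real
  assumes "0 < r" "r < s" "s < 1" "r < t" "0 \<le> \<mu>" "\<mu> \<le> pi" "cmod a = 1" "cmod b = r"
  obtains v where "v \<in> {\<mu>..pi}"
    "cross_ratio a (of_real s) b (of_real t * cis \<mu>)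
     \<le> cross_ratio (cis (- outer_angle r s v)) (of_real s) (of_real r * cis v) (of_real t * cis \<mu>)"
proof -
  define y where "y = of_real t * cis \<mu>"
  have ne: "c \<noteq> of_real s" if "cmod c = 1" for c
    using that assms by auto
  have ne': "c \<noteq> y" if "cmod c = r" for c
    using that assms by (auto simp: y_def norm_mult)
  have le: "cross_ratio c (of_real s) d y \<le> cross_ratio c' (of_real s) d' y"
    if "cmod c = 1" "cmod c' = 1" "cmod d = r" "cmod d' = r"
      "cmod (c - d) * cmod (c' - of_real s) \<le> cmod (c' - d') * cmod (c - of_real s)"
      "cmod (d' - y) \<le> cmod (d - y)" for c d c' d'
    using mult_mono[OF that(5,6)] that(1-4) ne ne' by (intro cross_ratio_le) (auto simp: mult_ac)
  have nb: "(cmod (of_real r * cis \<beta> - y))\<^sup>2 = r\<^sup>2 + t\<^sup>2 - 2 * r * t * cos (\<beta> - \<mu>)" for \<beta>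
    unfolding y_def by (rule norm_polar_diff_power2)
  have nab: "(cmod (cis \<alpha> - of_real r * cis \<beta>))\<^sup>2 = 1 + r\<^sup>2 - 2 * r * cos (\<alpha> - \<beta>)" for \<alpha> \<beta>
    using norm_polar_diff_power2[of 1 \<alpha> r \<beta>] by simp
  have na: "(cmod (cis \<alpha> - of_real s))\<^sup>2 = 1 + s\<^sup>2 - 2 * s * cos \<alpha>" for \<alpha>
    using norm_polar_diff_power2[of 1 \<alpha> s 0] by simp
  obtain \<theta> w where w: "0 \<le> w" "w \<le> pi"
    and 1: "cross_ratio a (of_real s) b y \<le> cross_ratio (cis \<theta>) (of_real s) (of_real r * cis w) y"
  proof -
    have a: "a = cis (Arg a)" and b: "b = of_real r * cis (Arg b)"
      using rcis_cmod_Arg[of a] rcis_cmod_Arg[of b] assms by (simp_all add: rcis_def)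
    show ?thesis
    proof (cases "0 \<le> Arg b")
      case True
      then show ?thesis
        using that[of "Arg b" "Arg a"] Arg_le_pi[of b] a b by auto
    next
      case False
      define w where "w = - Arg b"
      have w: "0 \<le> w" "w \<le> pi"
        using False mpi_less_Arg[of b] by (auto simp: w_def)
      have "cross_ratio (cis (Arg a)) (of_real s) (of_real r * cis (- w)) y
          \<le> cross_ratio (cis (- Arg a)) (of_real s) (of_real r * cis w) y"
      proof (rule le)
        have "cos (- w - \<mu>) \<le> cos (w - \<mu>)"
          using w assms by (simp add: cos_diff sin_ge_zero mult_nonneg_nonneg)
        then have "r * t * cos (- w - \<mu>) \<le> r * t * cos (w - \<mu>)"
          using assms by (intro mult_left_mono) auto
        then have "(cmod (of_real r * cis w - y))\<^sup>2 \<le> (cmod (of_real r * cis (- w) - y))\<^sup>2"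
          unfolding nb by simp
        then show "cmod (of_real r * cis w - y) \<le> cmod (of_real r * cis (- w) - y)"
          by (rule power2_le_imp_le) simp
        have "(cmod (cis (Arg a) - of_real r * cis (- w)))\<^sup>2 = (cmod (cis (- Arg a) - of_real r * cis w))\<^sup>2"
          unfolding nab by (simp add: cos_diff cos_add)
        moreover have "(cmod (cis (- Arg a) - of_real s))\<^sup>2 = (cmod (cis (Arg a) - of_real s))\<^sup>2"
          unfolding na by simp
        ultimately show "cmod (cis (Arg a) - of_real r * cis (- w)) * cmod (cis (- Arg a) - of_real s)
            \<le> cmod (cis (- Arg a) - of_real r * cis w) * cmod (cis (Arg a) - of_real s)"
          by (simp add: power2_eq_iff_nonneg)
      qed (use assms in \<open>auto simp: norm_mult\<close>)
      moreover have "- w = Arg b"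
        by (simp add: w_def)
      ultimately show ?thesis
        using that[OF w] a b by metis
    qed
  qed
  define u where "u = outer_angle r s w"
  have u: "0 \<le> u" "u \<le> pi"
    using outer_angle_critical(6,7)[OF assms(1-3) w] by (simp_all add: u_def)
  have 2: "cross_ratio (cis \<theta>) (of_real s) (of_real r * cis w) y
      \<le> cross_ratio (cis (- u)) (of_real s) (of_real r * cis w) y"
    unfolding u_def using assms
    by (intro le outer_angle_maximal w) (auto simp: norm_mult)
  show ?thesis
  proof (cases "\<mu> \<le> w")
    case True
    then show ?thesis
      using that[of w] w 1 2 by (auto simp: u_def y_def)
  next
    case False
    \<comment> \<open>Rotating both points by \<mu> - w brings \<open>b\<close> to argument \<mu>
      and keeps |a - b|. If \<open>a\<close> would pass the positive real axis it stops at 1; the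
      angle between the points then grows from u + w to \<mu>.\<close>
    define u' where "u' = max 0 (u + w - \<mu>)"
    have u': "0 \<le> u'" "u' \<le> u"
      using False u by (auto simp: u'_def)
    have 3: "cross_ratio (cis (- u)) (of_real s) (of_real r * cis w) y
        \<le> cross_ratio (cis (- u')) (of_real s) (of_real r * cis \<mu>) y"
    proof (rule le)
      have "r * t * cos (w - \<mu>) \<le> r * t * 1"
        using assms by (intro mult_left_mono) auto
      then have "(cmod (of_real r * cis \<mu> - y))\<^sup>2 \<le> (cmod (of_real r * cis w - y))\<^sup>2"
        unfolding nb by simp
      then show "cmod (of_real r * cis \<mu> - y) \<le> cmod (of_real r * cis w - y)"
        by (rule power2_le_imp_le) simp
      have "cos (u' + \<mu>) \<le> cos (u + w)"
      proof (cases "\<mu> \<le> u + w")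
        case True
        then show ?thesis by (simp add: u'_def)
      next
        case False
        then show ?thesis
          using u w assms by (auto simp: u'_def intro: cos_monotone_0_pi_le)
      qed
      moreover have "cos (- u - w) = cos (u + w)" "cos (- u' - \<mu>) = cos (u' + \<mu>)"
        by (metis cos_minus minus_add_distrib uminus_add_conv_diff add.commute diff_conv_add_uminus)+
      ultimately have "(cmod (cis (- u) - of_real r * cis w))\<^sup>2 \<le> (cmod (cis (- u') - of_real r * cis \<mu>))\<^sup>2"
        unfolding nab using assms by simp
      then have "cmod (cis (- u) - of_real r * cis w) \<le> cmod (cis (- u') - of_real r * cis \<mu>)"
        by (rule power2_le_imp_le) simp
      moreover have "cos u \<le> cos u'"
        using u u' by (intro cos_monotone_0_pi_le) auto
      then have "(cmod (cis (- u') - of_real s))\<^sup>2 \<le> (cmod (cis (- u) - of_real s))\<^sup>2"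
        unfolding na using assms by simp
      then have "cmod (cis (- u') - of_real s) \<le> cmod (cis (- u) - of_real s)"
        by (rule power2_le_imp_le) simp
      ultimately show "cmod (cis (- u) - of_real r * cis w) * cmod (cis (- u') - of_real s)
          \<le> cmod (cis (- u') - of_real r * cis \<mu>) * cmod (cis (- u) - of_real s)"
        by (rule mult_mono) auto
    qed (use assms in \<open>auto simp: norm_mult\<close>)
    \<comment> \<open>The rotated \<open>a\<close> need not be optimal for the new \<open>b\<close>,
      so it is optimised once more.\<close>
    have "cross_ratio (cis (- u')) (of_real s) (of_real r * cis \<mu>) y
        \<le> cross_ratio (cis (- outer_angle r s \<mu>)) (of_real s) (of_real r * cis \<mu>) y"
      using assms by (intro le outer_angle_maximal) (auto simp: norm_mult)
    then show ?thesis
      using that[of \<mu>] 1 2 3 assms by (auto simp: y_def)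
  qed
qed

text \<open>The reflection interchanging the directions of \<open>x\<close> and \<open>y\<close> swaps the circles; the new position is
  better because \<open>y\<close> is the point closer to the inner circle.\<close>

lemma cross_ratio_inner_outer_le:
  fixes a b :: complex and r s t \<mu> :: real
  assumes "0 < r" "r < t" "t \<le> s" "s < 1" "cmod a = r" "cmod b = 1"
  obtains a' b' where "cmod a' = 1" "cmod b' = r"
    "cross_ratio a (of_real s) b (of_real t * cis \<mu>) \<le> cross_ratio a' (of_real s) b' (of_real t * cis \<mu>)"
proof -
  define y where "y = of_real t * cis \<mu>"
  define \<alpha> \<beta> where "\<alpha> = Arg a" and "\<beta> = Arg b"
  \<comment> \<open>The reflection replaces the argument \<theta> by \<mu> - \<theta>:
    \<open>a'\<close> is the mirror image of \<open>b\<close>, and \<open>b'\<close> that of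
    \<open>a\<close>.\<close>
  define a' where "a' = cis (\<mu> - \<beta>)"
  define b' where "b' = of_real r * cis (\<mu> - \<alpha>)"
  have a: "a = of_real r * cis \<alpha>" and b: "b = cis \<beta>"
    using rcis_cmod_Arg[of a] rcis_cmod_Arg[of b] assms by (simp_all add: rcis_def \<alpha>_def \<beta>_def)
  define p q where "p = cos \<alpha>" and "q = cos (\<mu> - \<beta>)"
  have "(cmod (a - b))\<^sup>2 = (cmod (a' - b'))\<^sup>2"
    using norm_polar_diff_power2[of r \<alpha> 1 \<beta>] norm_polar_diff_power2[of 1 "\<mu> - \<beta>" r "\<mu> - \<alpha>"]
    by (simp add: a b a'_def b'_def)
  then have ab: "cmod (a - b) = cmod (a' - b')"
    by (simp add: power2_eq_iff_nonneg)
  have ax: "(cmod (a - of_real s))\<^sup>2 = r\<^sup>2 + s\<^sup>2 - 2 * r * s * p"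
    using norm_polar_diff_power2[of r \<alpha> s 0] by (simp add: a p_def)
  have b'y: "(cmod (b' - y))\<^sup>2 = r\<^sup>2 + t\<^sup>2 - 2 * r * t * p"
    using norm_polar_diff_power2[of r "\<mu> - \<alpha>" t \<mu>] by (simp add: b'_def y_def p_def)
  have a'x: "(cmod (a' - of_real s))\<^sup>2 = 1 + s\<^sup>2 - 2 * s * q"
    using norm_polar_diff_power2[of 1 "\<mu> - \<beta>" s 0] by (simp add: a'_def q_def)
  have "cos (\<beta> - \<mu>) = q"
    unfolding q_def by (metis cos_minus minus_diff_eq)
  then have by': "(cmod (b - y))\<^sup>2 = 1 + t\<^sup>2 - 2 * t * q"
    using norm_polar_diff_power2[of 1 \<beta> t \<mu>] by (simp add: b y_def)
  \<comment> \<open>After division by s t, this is the decrease of z + 1/z on (0, 1]; the second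
    estimate below is the increase of z + r^2/z for z \<ge> r. The weights s and t cancel in the
    product.\<close>
  have "t * (1 + s\<^sup>2 - 2 * s * q) - s * (1 + t\<^sup>2 - 2 * t * q) = - ((s - t) * (1 - s * t))"
    by (simp add: power2_eq_square algebra_simps)
  moreover have "s * t \<le> 1"
    using assms by (intro mult_le_one) auto
  ultimately have 1: "t * (cmod (a' - of_real s))\<^sup>2 \<le> s * (cmod (b - y))\<^sup>2"
    unfolding a'x by' using assms mult_nonneg_nonneg[of "s - t" "1 - s * t"] by linarith
  have "s * (r\<^sup>2 + t\<^sup>2 - 2 * r * t * p) - t * (r\<^sup>2 + s\<^sup>2 - 2 * r * s * p) = - ((s - t) * (s * t - r\<^sup>2))"
    by (simp add: power2_eq_square algebra_simps)
  moreover have "r\<^sup>2 \<le> s * t"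
    using assms unfolding power2_eq_square by (intro mult_mono) auto
  ultimately have 2: "s * (cmod (b' - y))\<^sup>2 \<le> t * (cmod (a - of_real s))\<^sup>2"
    unfolding ax b'y using assms mult_nonneg_nonneg[of "s - t" "s * t - r\<^sup>2"] by linarith
  have "(t * (cmod (a' - of_real s))\<^sup>2) * (s * (cmod (b' - y))\<^sup>2)
      \<le> (s * (cmod (b - y))\<^sup>2) * (t * (cmod (a - of_real s))\<^sup>2)"
    using assms by (intro mult_mono 1 2) auto
  then have "(s * t) * (cmod (a' - of_real s) * cmod (b' - y))\<^sup>2
      \<le> (s * t) * (cmod (a - of_real s) * cmod (b - y))\<^sup>2"
    by (simp add: power_mult_distrib mult_ac)
  then have "(cmod (a' - of_real s) * cmod (b' - y))\<^sup>2 \<le> (cmod (a - of_real s) * cmod (b - y))\<^sup>2"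
    using assms by simp
  then have 3: "cmod (a' - of_real s) * cmod (b' - y) \<le> cmod (a - of_real s) * cmod (b - y)"
    by (rule power2_le_imp_le) simp
  have n: "cmod a' = 1" "cmod b' = r" "cmod y = t"
    using assms by (auto simp: a'_def b'_def y_def norm_mult)
  have ne: "c \<noteq> d" if "cmod c \<noteq> cmod d" for c d :: complex
    using that by blast
  have "cross_ratio a (of_real s) b y \<le> cross_ratio a' (of_real s) b' y"
  proof (rule cross_ratio_le)
    show "cmod (a - b) * (cmod (a' - of_real s) * cmod (b' - y))
        \<le> cmod (a' - b') * (cmod (a - of_real s) * cmod (b - y))"
      unfolding ab by (intro mult_left_mono 3) simp
    show "a \<noteq> of_real s" "b \<noteq> y" "a' \<noteq> of_real s" "b' \<noteq> y"
      by (rule ne; use assms n in simp)+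
  qed
  then show ?thesis
    using that n by (simp add: y_def)
qed

section \<open>Normalisation and assembly of the maximum\<close>

text \<open>A rotation takes \<open>x\<close> to the positive real axis; conjugation follows if
  \<open>y\<close> lands on the wrong side. Surjectivity allows boundary points of the normalised
  picture to be pulled back.\<close>

lemma normalising_isometry:
  fixes x y :: complex
  assumes "x \<noteq> 0" "y \<noteq> 0"
  obtains \<phi> :: "complex \<Rightarrow> complex"
  where "\<And>z w. cmod (\<phi> z - \<phi> w) = cmod (z - w)" "\<And>z. cmod (\<phi> z) = cmod z" "surj \<phi>"
    "\<phi> x = of_real (cmod x)" "\<phi> y = of_real (cmod y) * cis (angle_at_origin x y)"
proof -
  define e where "e = cnj x / of_real (cmod x)"
  define Y where "Y = of_real (cmod y) * cis (angle_at_origin x y)"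
  have e: "cmod e = 1"
    using assms by (simp add: e_def norm_divide)
  have ex: "e * x = of_real (cmod x)"
    using assms by (simp add: e_def complex_norm_square power2_eq_square field_simps flip: complex_norm_square)
  have "x \<bullet> y \<le> cmod x * cmod y" "- (cmod x * cmod y) \<le> x \<bullet> y"
    using Cauchy_Schwarz_ineq2[of x y] by auto
  then have "cos (angle_at_origin x y) = (x \<bullet> y) / (cmod x * cmod y)"
    unfolding angle_at_origin_def using assms by (intro cos_arccos) (auto simp: divide_simps)
  then have re: "Re (e * y) = Re Y"
    using assms by (simp add: Y_def e_def inner_complex_def field_simps)
  have nm: "cmod (e * y) = cmod Y"
    by (simp add: Y_def norm_mult e)
  have "Im (e * y) = Im Y \<or> Im (e * y) = - Im Y"
    using nm re unfolding cmod_def by (simp add: power2_eq_iff)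
  then consider "e * y = Y" | "cnj (e * y) = Y"
    using re by (auto simp: complex_eq_iff)
  then show ?thesis
  proof cases
    case 1
    have "surj (\<lambda>z. e * z)"
      using e by (intro surjI[of _ "\<lambda>z. z / e"]) auto
    then show ?thesis
      using that[of "\<lambda>z. e * z"] 1 e ex by (simp add: norm_mult Y_def flip: right_diff_distrib)
  next
    case 2
    have "surj (\<lambda>z. cnj (e * z))"
      using e by (intro surjI[of _ "\<lambda>z. cnj z / e"]) auto
    moreover have "cmod (cnj (e * z) - cnj (e * w)) = cmod (z - w)" for z w
      by (metis complex_cnj_diff complex_mod_cnj e mult_1 norm_mult right_diff_distrib)
    ultimately show ?thesis
      using that[of "\<lambda>z. cnj (e * z)"] 2 e ex by (simp add: norm_mult Y_def)
  qed
qed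

text \<open>The members of \<open>S\<close> need not be values of \<open>f\<close>: it suffices that
  they lie below every upper bound. This admits an entry that is itself a supremum.\<close>

lemma cSUP_eq_Max:
  fixes f :: "'a \<Rightarrow> real"
  assumes "finite S" "S \<noteq> {}"
    and "\<And>p. p \<in> A \<Longrightarrow> \<exists>m\<in>S. f p \<le> m"
    and "\<And>m c. m \<in> S \<Longrightarrow> (\<And>p. p \<in> A \<Longrightarrow> f p \<le> c) \<Longrightarrow> m \<le> c"
    and "A \<noteq> {}"
  shows "(SUP p\<in>A. f p) = Max S"
proof (rule cSup_eq_non_empty)
  show "z \<le> Max S" if "z \<in> f ` A" for z
    using assms(1,3) that by (force intro: order_trans[OF _ Max_ge])
  show "Max S \<le> c" if "\<And>z. z \<in> f ` A \<Longrightarrow> z \<le> c" for c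
    using assms(1,2,4) that by simp
qed (use assms in auto)

theorem theorem4p1:
  fixes r \<mu> :: real and x y :: complex
  assumes "0 < r" and "r < 1"
    and "x \<in> annulus r 1" and "y \<in> annulus r 1"
    and "cmod y \<le> cmod x"
    and "\<mu> = angle_at_origin x y"
  shows "moebius_metric (Some ` annulus r 1) (Some x) (Some y) =
    Max {hyperbolic_dist x y,
         hyperbolic_dist (of_real r * x / of_real ((cmod x)\<^sup>2)) (of_real r * y / of_real ((cmod y)\<^sup>2)),
         (SUP v \<in> {\<mu>..pi}.
            ln (1 + cross_ratio (cis (- outer_angle r (cmod x) v))
                                (of_real (cmod x))
                                (of_real r * cis v)
                                (of_real (cmod y) * cis \<mu>)))}"
proof -
  define s t where "s = cmod x" and "t = cmod y"
  define B where "B = sphere (0::complex) 1 \<union> sphere 0 r"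
  define f where "f = (\<lambda>(a, b). ln (1 + cross_ratio a x b y))"
  define \<iota> where "\<iota> z = of_real r * z / of_real ((cmod z)\<^sup>2)" for z :: complex
  define g where "g v = ln (1 + cross_ratio (cis (- outer_angle r s v)) (of_real s)
      (of_real r * cis v) (of_real t * cis \<mu>))" for v
  have s: "r < s" "s < 1" and t: "r < t" "t < 1" "t \<le> s"
    using assms by (auto simp: annulus_def s_def t_def)
  have x0: "x \<noteq> 0" "y \<noteq> 0"
    using s t assms by (auto simp: s_def t_def)
  have "\<bar>x \<bullet> y / (cmod x * cmod y)\<bar> \<le> 1"
    using Cauchy_Schwarz_ineq2[of x y] x0 by (simp add: abs_mult divide_le_eq)
  then have \<mu>: "0 \<le> \<mu>" "\<mu> \<le> pi"
    unfolding assms(6) angle_at_origin_def abs_le_iff by (simp_all add: arccos_lbound arccos_ubound)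
  have mono: "ln (1 + cross_ratio a p b q) \<le> ln (1 + c)" if "cross_ratio a p b q \<le> c"
    for a p b q :: complex and c
    using that by (intro ln_mono) (auto simp: cross_ratio_def intro!: add_pos_nonneg)
  obtain \<phi> where iso: "\<And>z w. cmod (\<phi> z - \<phi> w) = cmod (z - w)" "\<And>z. cmod (\<phi> z) = cmod z" "surj \<phi>"
    and \<phi>x: "\<phi> x = of_real s" and \<phi>y: "\<phi> y = of_real t * cis \<mu>"
    using normalising_isometry[OF x0] assms(6) unfolding s_def t_def by blast
  have \<phi>: "cross_ratio (\<phi> a) (of_real s) (\<phi> b) (of_real t * cis \<mu>) = cross_ratio a x b y" for a b
    unfolding \<phi>x[symmetric] \<phi>y[symmetric] by (simp add: cross_ratio_def iso)
  have \<iota>: "cmod (\<iota> z) = r / cmod z" if "z \<noteq> 0" for z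
    using that assms by (simp add: \<iota>_def norm_mult norm_divide power2_eq_square)
  have \<iota>\<iota>: "\<iota> (\<iota> z) = z" if "z \<noteq> 0" for z
    using that assms \<iota>[OF that] by (simp add: \<iota>_def[of "\<iota> z"]) (simp add: \<iota>_def field_simps power2_eq_square)
  have \<iota>_cross: "cross_ratio (\<iota> a) (\<iota> x) (\<iota> b) (\<iota> y) = cross_ratio a x b y" if "a \<noteq> 0" "b \<noteq> 0" for a b
    unfolding \<iota>_def using that x0 assms by (intro cross_ratio_inversion) auto
  have \<iota>1: "cmod (\<iota> x) < 1" "cmod (\<iota> y) < 1"
    using x0 s t by (simp_all add: \<iota> s_def t_def)
  have fle: "\<exists>v\<in>{\<mu>..pi}. f (a, b) \<le> g v" if ab: "cmod a = 1" "cmod b = r" for a b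
  proof -
    obtain v where "v \<in> {\<mu>..pi}" "cross_ratio (\<phi> a) (of_real s) (\<phi> b) (of_real t * cis \<mu>)
      \<le> cross_ratio (cis (- outer_angle r s v)) (of_real s) (of_real r * cis v) (of_real t * cis \<mu>)"
      using cross_ratio_outer_inner_le[of r s t \<mu> "\<phi> a" "\<phi> b"] assms s t \<mu> ab iso(2) by metis
    then show ?thesis
      unfolding \<phi> f_def g_def prod.case by (blast intro: mono)
  qed
  have fle': "\<exists>v\<in>{\<mu>..pi}. f (a, b) \<le> g v" if ab: "cmod a = r" "cmod b = 1" for a b
  proof -
    obtain a' b' where *: "cmod a' = 1" "cmod b' = r" "cross_ratio (\<phi> a) (of_real s) (\<phi> b) (of_real t * cis \<mu>)
      \<le> cross_ratio a' (of_real s) b' (of_real t * cis \<mu>)"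
      using cross_ratio_inner_outer_le[of r t s "\<phi> a" "\<phi> b" \<mu>] assms s t ab iso(2) by metis
    obtain a'' b'' where **: "a' = \<phi> a''" "b' = \<phi> b''"
      using iso(3) by (metis surjD)
    have "f (a, b) \<le> f (a'', b'')"
      using *(3) unfolding ** \<phi> f_def prod.case by (rule mono)
    moreover
    have "cmod a'' = 1" "cmod b'' = r"
      using * iso(2) unfolding ** by auto
    then have "\<exists>v\<in>{\<mu>..pi}. f (a'', b'') \<le> g v"
      by (rule fle)
    ultimately show ?thesis
      using order_trans by blast
  qed
  \<comment> \<open>Each \<open>g v\<close> is a value of \<open>f\<close>, so the third entry
    cannot exceed an upper bound of \<open>f\<close>.\<close>
  have g: "\<exists>p\<in>B \<times> B. g v = f p" for v
  proof -
    obtain a b where ab: "cis (- outer_angle r s v) = \<phi> a" "of_real r * cis v = \<phi> b"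
      using iso(3) by (metis surjD)
    have "cmod (\<phi> a) = 1" "cmod (\<phi> b) = r"
      using assms by (auto simp: norm_mult simp flip: ab)
    then have "(a, b) \<in> B \<times> B"
      by (simp add: B_def iso(2))
    moreover have "g v = f (a, b)"
      unfolding g_def ab \<phi> f_def by simp
    ultimately show ?thesis
      by blast
  qed
  \<comment> \<open>A real supremum dominates its members only over a bounded set. Here 1 - s and t
    - r keep the denominators away from 0.\<close>
  have bdd: "bdd_above (g ` {\<mu>..pi})"
  proof (rule bdd_aboveI2)
    fix v
    have "cmod (cis \<alpha> - of_real s) \<ge> 1 - s" for \<alpha>
      using norm_triangle_ineq2[of "cis \<alpha>" "of_real s"] s assms by simp
    moreover have "cmod (of_real r * cis v - of_real t * cis \<mu>) \<ge> t - r"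
      using norm_triangle_ineq2[of "of_real t * cis \<mu>" "of_real r * cis v"] t assms
      by (simp add: norm_mult norm_minus_commute)
    moreover have "cmod (cis \<alpha> - of_real r * cis v) \<le> 1 + r" for \<alpha>
      using norm_triangle_ineq4[of "cis \<alpha>" "of_real r * cis v"] assms by (simp add: norm_mult)
    ultimately have "cross_ratio (cis (- outer_angle r s v)) (of_real s) (of_real r * cis v) (of_real t * cis \<mu>)
        \<le> (1 + r) * cmod (of_real s - of_real t * cis \<mu>) / ((1 - s) * (t - r))"
      unfolding cross_ratio_def using s t assms(1) by (intro frac_le mult_mono mult_nonneg_nonneg mult_pos_pos) auto
    then show "g v \<le> ln (1 + (1 + r) * cmod (of_real s - of_real t * cis \<mu>) / ((1 - s) * (t - r)))"
      unfolding g_def by (rule mono)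
  qed
  have "moebius_metric (Some ` annulus r 1) (Some x) (Some y)
      = (SUP (a, b) \<in> Some ` B \<times> Some ` B. ln (1 + ext_cross_ratio a (Some x) b (Some y)))"
    unfolding moebius_metric_def Let_def B_def using assms by (simp add: frontier_of_Some_annulus)
  also have "Some ` B \<times> Some ` B = map_prod Some Some ` (B \<times> B)"
    by (rule map_prod_surj_on[symmetric]) auto
  also have "(SUP (a, b) \<in> \<dots>. ln (1 + ext_cross_ratio a (Some x) b (Some y))) = (SUP p \<in> B \<times> B. f p)"
    unfolding image_image by (rule SUP_cong) (auto simp: f_def)
  also have "\<dots> = Max {hyperbolic_dist x y, hyperbolic_dist (\<iota> x) (\<iota> y), SUP v\<in>{\<mu>..pi}. g v}" (is "_ = Max ?S")
  proof (rule cSUP_eq_Max)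
    fix p assume "p \<in> B \<times> B"
    then obtain a b where p: "p = (a, b)" and "cmod a = 1 \<or> cmod a = r" "cmod b = 1 \<or> cmod b = r"
      by (auto simp: B_def)
    then consider "cmod a = 1" "cmod b = 1" | "cmod a = r" "cmod b = r"
      | "\<exists>v\<in>{\<mu>..pi}. f p \<le> g v"
      using fle fle' by blast
    then show "\<exists>m\<in>?S. f p \<le> m"
    proof cases
      case 1
      then have "f p \<le> hyperbolic_dist x y"
        unfolding p f_def using s t by (auto simp: s_def t_def intro: ln_cross_ratio_le_hyperbolic_dist)
      then show ?thesis by blast
    next
      case 2
      then have ab: "a \<noteq> 0" "b \<noteq> 0"
        using assms by auto
      then have "ln (1 + cross_ratio (\<iota> a) (\<iota> x) (\<iota> b) (\<iota> y)) \<le> hyperbolic_dist (\<iota> x) (\<iota> y)"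
        using 2 assms by (intro ln_cross_ratio_le_hyperbolic_dist \<iota>1) (auto simp: \<iota>)
      then have "f p \<le> hyperbolic_dist (\<iota> x) (\<iota> y)"
        by (simp add: p f_def \<iota>_cross ab)
      then show ?thesis by blast
    next
      case 3
      then have "f p \<le> (SUP v\<in>{\<mu>..pi}. g v)"
        using bdd by (meson cSUP_upper2)
      then show ?thesis by blast
    qed
  next
    fix m c assume m: "m \<in> ?S" and c: "\<And>p. p \<in> B \<times> B \<Longrightarrow> f p \<le> c"
    have "hyperbolic_dist x y \<le> c"
    proof -
      obtain a b where "cmod a = 1" "cmod b = 1" "ln (1 + cross_ratio a x b y) = hyperbolic_dist x y"
        using hyperbolic_dist_attained[of x y] s t by (auto simp: s_def t_def)
      then show ?thesis
        using c[of "(a, b)"] by (simp add: B_def f_def)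
    qed
    \<comment> \<open>The extremal pair on the unit circle is carried to the inner circle by
      \<iota>, which is an involution.\<close>
    moreover have "hyperbolic_dist (\<iota> x) (\<iota> y) \<le> c"
    proof -
      obtain a b where ab: "cmod a = 1" "cmod b = 1"
        "ln (1 + cross_ratio a (\<iota> x) b (\<iota> y)) = hyperbolic_dist (\<iota> x) (\<iota> y)"
        using hyperbolic_dist_attained[OF \<iota>1] by blast
      have ab0: "a \<noteq> 0" "b \<noteq> 0"
        using ab by auto
      then have "cmod (\<iota> a) = r" "cmod (\<iota> b) = r"
        using ab by (simp_all add: \<iota>)
      moreover from this have "\<iota> a \<noteq> 0" "\<iota> b \<noteq> 0"
        using assms by auto
      then have "f (\<iota> a, \<iota> b) = hyperbolic_dist (\<iota> x) (\<iota> y)"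
        using \<iota>_cross[of "\<iota> a" "\<iota> b"] ab ab0 by (simp add: f_def \<iota>\<iota>)
      ultimately show ?thesis
        using c[of "(\<iota> a, \<iota> b)"] by (simp add: B_def)
    qed
    moreover have "(SUP v\<in>{\<mu>..pi}. g v) \<le> c"
      using \<mu> g c by (intro cSUP_least) (auto, metis)
    ultimately show "m \<le> c"
      using m by auto
  qed (auto simp: B_def intro!: exI[of _ "1::complex"])
  finally show ?thesis
    by (simp add: g_def \<iota>_def s_def t_def)
qed

end
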